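(* Let $N\ge 3$ and let $x\in\mathfrak{A}_N$ have only cycles of odd length. Then the interval $[e,x]_{\mathbf 3}$ of $(\mathfrak{A}_N,\le_{\mathbf 3})$ is an induced subposet of the interval $[e,x]_{\mathbf 2}$ of $(\mathfrak{S}_N,\le_{\mathbf 2})$; that is, $[e,x]_{\mathbf 3}\subseteq[e,x]_{\mathbf 2}$ and for all $y,z\in[e,x]_{\mathbf 3}$ one has $y\le_{\mathbf 3}z$ if and only if $y\le_{\mathbf 2}z$.
   Context: $\mathfrak{S}_N$ is the symmetric group on $[N]=\{1,\dots,N\}$, $\mathfrak{A}_N$ the alternating group, $e$ the identity. Cycles of a permutation include its fixed points (length $1$, hence odd). For $x\in\mathfrak{S}_N$, $\ell_{\mathbf 2}(x)$ is the minimal number of transpositions with product $x$, and $x\le_{\mathbf 2}y$ iff $\ell_{\mathbf 2}(y)=\ell_{\mathbf 2}(x)+\ell_{\mathbf 2}(x^{-1}y)$. For $x\in\mathfrak{A}_N$, $\ell_{\mathbf 3}(x)$ is the minimal number of $3$-cycles with product $x$, and $x\le_{\mathbf 3}y$ iff $\ell_{\mathbf 3}(y)=\ell_{\mathbf 3}(x)+\ell_{\mathbf 3}(x^{-1}y)$. $[u,v]_{\mathbf i}=\{w: u\le_{\mathbf i}w\le_{\mathbf i}v\}$. *)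

theory Defs
  imports "HOL-Algebra.Sym_Groups" "HOL-Combinatorics.Orbits"
begin

definition transpositions :: "nat \<Rightarrow> (nat \<Rightarrow> nat) set" where
  "transpositions N = {transpose a b | a b. a \<in> {1..N} \<and> b \<in> {1..N} \<and> a \<noteq> b}"

text \<open>The following definitions are meant for a set \<open>T\<close> of generators of \<open>G\<close> that is closed
  under inverses. Then every element of \<open>G\<close> is the product of some word over \<open>T\<close>,
  so that \<open>LEAST\<close> ranges over a nonempty set.\<close>

definition gen_length :: "('a, 'b) monoid_scheme \<Rightarrow> 'a set \<Rightarrow> 'a \<Rightarrow> nat" where
  "gen_length G T x =
     (LEAST k. \<exists>ts. length ts = k \<and> set ts \<subseteq> T \<and> foldr (\<otimes>\<^bsub>G\<^esub>) ts \<one>\<^bsub>G\<^esub> = x)"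

definition gen_le :: "('a, 'b) monoid_scheme \<Rightarrow> 'a set \<Rightarrow> 'a \<Rightarrow> 'a \<Rightarrow> bool" where
  "gen_le G T x y \<longleftrightarrow> x \<in> carrier G \<and> y \<in> carrier G \<and>
     gen_length G T y = gen_length G T x + gen_length G T (inv\<^bsub>G\<^esub> x \<otimes>\<^bsub>G\<^esub> y)"

definition le2 :: "nat \<Rightarrow> (nat \<Rightarrow> nat) \<Rightarrow> (nat \<Rightarrow> nat) \<Rightarrow> bool" where
  "le2 N = gen_le (sym_group N) (transpositions N)"

definition le3 :: "nat \<Rightarrow> (nat \<Rightarrow> nat) \<Rightarrow> (nat \<Rightarrow> nat) \<Rightarrow> bool" where
  "le3 N = gen_le (alt_group N) (three_cycles N)"

definition interval2 :: "nat \<Rightarrow> (nat \<Rightarrow> nat) \<Rightarrow> (nat \<Rightarrow> nat) \<Rightarrow> (nat \<Rightarrow> nat) set" where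
  "interval2 N u v = {w. le2 N u w \<and> le2 N w v}"

definition interval3 :: "nat \<Rightarrow> (nat \<Rightarrow> nat) \<Rightarrow> (nat \<Rightarrow> nat) \<Rightarrow> (nat \<Rightarrow> nat) set" where
  "interval3 N u v = {w. le3 N u w \<and> le3 N w v}"

text \<open>The cycles of a permutation of \<open>{1..N}\<close> are its orbits on \<open>{1..N}\<close>, fixed points giving
  singletons; the length of a cycle is the cardinality of the orbit.\<close>

definition only_odd_cycles :: "nat \<Rightarrow> (nat \<Rightarrow> nat) \<Rightarrow> bool" where
  "only_odd_cycles N x \<longleftrightarrow> (\<forall>i\<in>{1..N}. odd (card (orbit x i)))"

end

theory Submission
  imports Defs "HOL-Library.Z2" "HOL-Library.Function_Algebras"
begin

text \<open>
  To a permutation \<open>p\<close> attach the space \<open>M p\<close> of all \<open>f \<circ> p + f\<close>, where \<open>f\<close> takes values in the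
  field with two elements; it consists of the functions whose sum over every cycle of \<open>p\<close> vanishes.
  Its cardinality is \<open>2 ^ \<ell>\<^sub>2 p\<close>, and \<open>M (p \<circ> q) \<subseteq> M p + M q\<close>, so \<open>\<ell>\<^sub>2\<close> is additive on \<open>p \<circ> q\<close>
  iff \<open>M (p \<circ> q)\<close> is the direct sum of \<open>M p\<close> and \<open>M q\<close>. A 3-cycle is a product of two
  transpositions, hence \<open>\<ell>\<^sub>2 \<le> 2 \<ell>\<^sub>3\<close>, with equality exactly for permutations with only odd cycles.
  Everything then follows by counting, except that for \<open>y \<le>\<^sub>2 z\<close> in the interval below \<open>x\<close> the
  permutation \<open>w = y\<^sup>-\<^sup>1 z\<close> has only odd cycles.

  Put \<open>v = z\<^sup>-\<^sup>1 x\<close>, so that \<open>y\<close>, \<open>v\<close>, \<open>y w\<close> and \<open>w v\<close> have only odd cycles. Let \<open>g\<close> be the indicator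
  function of a set of representatives of the even cycles of \<open>w\<close>. On a cycle \<open>C\<close> of \<open>y w\<close> both \<open>y\<close>
  and \<open>y w\<close> restrict to even permutations, so \<open>w\<close> does as well and \<open>C\<close> contains an even
  number of even cycles of \<open>w\<close>. Thus \<open>g \<in> M (y w)\<close>, and likewise \<open>g \<in> M (w v)\<close>. As
  \<open>M (y w v)\<close> is the direct sum of \<open>M y\<close>, \<open>M w\<close> and \<open>M v\<close>, these two spaces intersect in \<open>M w\<close>,
  so \<open>g\<close> sums to \<open>0\<close> over the cycles of \<open>w\<close>; but it sums to \<open>1\<close> over the even ones.
\<close>


subsection \<open>The space attached to a permutation\<close>

declare add_bit_eq_xor [simp del] mult_bit_eq_and [simp del]

lemma bit_add_self [simp]: "a + a = (0::bit)"
  by (cases a) simp_all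

lemma bit_add_eq_0_iff: "a + b = 0 \<longleftrightarrow> a = (b::bit)"
  by (cases a; cases b) simp_all

lemma bit_add_telescope: "a + b = (c + b) + (a + (c::bit))"
  by (cases a; cases b; cases c) simp_all

lemma fun_bit_add_self [simp]: "f + f = (0 :: 'a \<Rightarrow> bit)"
  by (simp add: fun_eq_iff)

lemma fun_bit_add_self_left [simp]: "f + (f + g) = (g :: 'a \<Rightarrow> bit)"
  by (simp flip: add.assoc)

lemma sum_bit_eq_card: "finite A \<Longrightarrow> (\<Sum>i\<in>A. of_bool (P i) :: bit) = of_nat (card {i\<in>A. P i})"
  by (simp add: Int_def)

lemma of_nat_bit_eq_0_iff: "(of_nat n :: bit) = 0 \<longleftrightarrow> even n"
  by (induction n) (auto simp: bit_add_eq_0_iff)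

definition delta :: "'a \<Rightarrow> 'a \<Rightarrow> bit" where
  "delta a = (\<lambda>i. of_bool (i = a))"

lemma delta_apply: "delta a i = of_bool (i = a)"
  by (simp add: delta_def)

definition moved_space :: "('a \<Rightarrow> 'a) \<Rightarrow> ('a \<Rightarrow> bit) set" where
  "moved_space p = range (\<lambda>f. (f \<circ> p) + f)"

lemma moved_spaceI: "(f \<circ> p) + f \<in> moved_space p"
  by (simp add: moved_space_def)

lemma zero_in_moved_space [simp]: "0 \<in> moved_space p"
  using moved_spaceI[of 0 p] by (simp add: zero_fun_def comp_def plus_fun_def)

lemma moved_space_add:
  assumes "f \<in> moved_space p" "g \<in> moved_space p"
  shows "f + g \<in> moved_space p"
proof -
  from assms obtain f' g' where "f = (f' \<circ> p) + f'" "g = (g' \<circ> p) + g'"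
    by (auto simp: moved_space_def)
  then have "f + g = ((f' + g') \<circ> p) + (f' + g')"
    by (simp add: fun_eq_iff ac_simps)
  then show ?thesis using moved_spaceI by metis
qed

lemma moved_space_id: "moved_space id = {0}"
  by (auto simp: moved_space_def)

lemma moved_space_fixpoint:
  assumes "f \<in> moved_space p" "p a = a" shows "f a = 0"
  using assms by (auto simp: moved_space_def)

lemma moved_space_outside:
  assumes "f \<in> moved_space p" "p permutes S" "i \<notin> S" shows "f i = 0"
  using assms by (auto intro: moved_space_fixpoint simp: permutes_not_in)

lemma finite_moved_space:
  assumes "p permutes S" "finite S"
  shows "finite (moved_space p)"
proof (rule finite_subset)
  show "moved_space p \<subseteq> {f. \<forall>i. (i \<in> S \<longrightarrow> f i \<in> {0, 1}) \<and> (i \<notin> S \<longrightarrow> f i = 0)}"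
    using moved_space_outside[OF _ assms(1)] by auto
  show "finite {f. \<forall>i. (i \<in> S \<longrightarrow> f i \<in> {0, 1 :: bit}) \<and> (i \<notin> S \<longrightarrow> f i = 0)}"
    by (rule finite_set_of_finite_funs) (use assms in auto)
qed

lemma moved_space_comp:
  assumes "h \<in> moved_space (p \<circ> q)"
  obtains f g where "f \<in> moved_space p" "g \<in> moved_space q" "h = f + g"
proof -
  obtain k where "h = (k \<circ> (p \<circ> q)) + k"
    using assms by (auto simp: moved_space_def)
  then have "h = ((k \<circ> p) + k) + (((k \<circ> p) \<circ> q) + (k \<circ> p))"
    using bit_add_telescope by (simp add: fun_eq_iff)
  then show thesis using that moved_spaceI by blast
qed

lemma moved_space_comp_subset:
  "moved_space (p \<circ> q) \<subseteq> (\<lambda>(f, g). f + g) ` (moved_space p \<times> moved_space q)"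
proof
  fix h assume "h \<in> moved_space (p \<circ> q)"
  then obtain f g where "f \<in> moved_space p" "g \<in> moved_space q" "h = f + g"
    by (rule moved_space_comp)
  then show "h \<in> (\<lambda>(f, g). f + g) ` (moved_space p \<times> moved_space q)"
    by (intro image_eqI[of _ _ "(f, g)"]) simp_all
qed

lemma card_moved_space_comp:
  assumes "p permutes S" "q permutes S" "finite S"
  shows "card (moved_space (p \<circ> q)) \<le> card (moved_space p) * card (moved_space q)"
proof -
  have fin: "finite (moved_space p \<times> moved_space q)"
    using assms by (simp add: finite_moved_space)
  have "card (moved_space (p \<circ> q)) \<le> card ((\<lambda>(f, g). f + g) ` (moved_space p \<times> moved_space q))"
    using moved_space_comp_subset fin by (intro card_mono) auto
  also have "\<dots> \<le> card (moved_space p \<times> moved_space q)"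
    using fin by (rule card_image_le)
  finally show ?thesis by (simp add: card_cartesian_product)
qed

lemma
  assumes "p permutes S" "q permutes S" "finite S"
    and card_eq: "card (moved_space (p \<circ> q)) = card (moved_space p) * card (moved_space q)"
  shows moved_space_left_subset: "moved_space p \<subseteq> moved_space (p \<circ> q)"
    and moved_space_right_subset: "moved_space q \<subseteq> moved_space (p \<circ> q)"
    and moved_space_disjoint: "\<lbrakk>f \<in> moved_space p; f \<in> moved_space q\<rbrakk> \<Longrightarrow> f = 0"
proof -
  let ?A = "moved_space p \<times> moved_space q" and ?s = "\<lambda>(f, g). f + g :: 'a \<Rightarrow> bit"
  have fin: "finite ?A" using assms by (simp add: finite_moved_space)
  have sub: "moved_space (p \<circ> q) \<subseteq> ?s ` ?A" by (rule moved_space_comp_subset)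
  have card_A: "card ?A = card (moved_space (p \<circ> q))" using card_eq by (simp add: card_cartesian_product)
  have le: "card (?s ` ?A) \<le> card ?A" using fin by (rule card_image_le)
  have eq: "moved_space (p \<circ> q) = ?s ` ?A"
    using fin sub le card_A by (intro card_seteq) auto
  then have inj: "inj_on ?s ?A" using fin card_A by (intro eq_card_imp_inj_on) auto
  show "moved_space p \<subseteq> moved_space (p \<circ> q)"
  proof
    fix f assume "f \<in> moved_space p"
    then have "?s (f, 0) \<in> ?s ` ?A" by (intro imageI SigmaI zero_in_moved_space)
    then show "f \<in> moved_space (p \<circ> q)" unfolding eq by simp
  qed
  show "moved_space q \<subseteq> moved_space (p \<circ> q)"
  proof
    fix f assume "f \<in> moved_space q"
    then have "?s (0, f) \<in> ?s ` ?A" by (intro imageI SigmaI zero_in_moved_space)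
    then show "f \<in> moved_space (p \<circ> q)" unfolding eq by simp
  qed
  show "f = 0" if "f \<in> moved_space p" "f \<in> moved_space q" for f
  proof -
    have "?s (f, f) = ?s (0, 0)" by simp
    then have "(f, f) = (0, 0)" by (rule inj_onD[OF inj]) (use that in auto)
    then show ?thesis by simp
  qed
qed

lemma delta_step_in_moved_space:
  assumes "inj p" shows "delta a + delta (p a) \<in> moved_space p"
proof -
  have "delta a + delta (p a) = (delta (p a) \<circ> p) + delta (p a)"
    using assms by (auto simp: fun_eq_iff delta_apply inj_eq)
  then show ?thesis using moved_spaceI by metis
qed

lemma delta_orbit_in_moved_space:
  assumes "inj p" "b \<in> orbit p a" shows "delta a + delta b \<in> moved_space p"
  using assms(2)
proof induction
  case base
  then show ?case using assms(1) by (rule delta_step_in_moved_space)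
next
  case (step c)
  have "(delta a + delta c) + (delta c + delta (p c)) \<in> moved_space p"
    using step.IH delta_step_in_moved_space[OF assms(1)] by (rule moved_space_add)
  also have "(delta a + delta c) + (delta c + delta (p c)) = delta a + delta (p c)"
    by (simp add: add.assoc)
  finally show ?case .
qed

lemma moved_space_transpose: "moved_space (transpose a b) \<subseteq> {0, delta a + delta b}"
proof
  fix h assume "h \<in> moved_space (transpose a b)"
  then obtain f where h: "h = (f \<circ> transpose a b) + f" by (auto simp: moved_space_def)
  have "h = (if f a = f b then 0 else delta a + delta b)"
    by (cases "f a"; cases "f b"; auto simp: h fun_eq_iff delta_apply transpose_def)
  then show "h \<in> {0, delta a + delta b}" by simp
qed

lemma card_moved_space_transpose: "card (moved_space (transpose a b)) \<le> 2"
  using card_mono[OF _ moved_space_transpose[of a b]] card_insert_le_m1[of 2 "{delta a + delta b}" 0]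
  by simp

lemma sum_moved_space:
  assumes "f \<in> moved_space p" "bij_betw p C C"
  shows "sum f C = 0"
proof -
  obtain g where f: "f = (g \<circ> p) + g" using assms(1) by (auto simp: moved_space_def)
  have "sum (g \<circ> p) C = sum g C"
    using sum.reindex_bij_betw[OF assms(2), of g] by (simp add: comp_def)
  then show ?thesis by (simp add: f sum.distrib)
qed

lemma bij_betw_orbit:
  assumes "permutation p" shows "bij_betw p (orbit p i) (orbit p i)"
proof -
  have "p ` orbit p i \<subseteq> orbit p i" by (auto intro: orbit.step)
  moreover have "finite (orbit p i)"
    using assms by (intro finite_orbit permutation_self_in_orbit)
  moreover have "inj_on p (orbit p i)"
    using permutation_bijective[OF assms] by (simp add: bij_def inj_on_def)
  ultimately show ?thesis by (simp add: bij_betw_def endo_inj_surj)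
qed

lemma moved_space_iff_sum_orbit:
  assumes p: "p permutes S" and "finite S"
  shows "f \<in> moved_space p \<longleftrightarrow> (\<forall>i. i \<notin> S \<longrightarrow> f i = 0) \<and> (\<forall>i\<in>S. sum f (orbit p i) = 0)"
proof (intro iffI conjI; (elim conjE)?)
  have perm: "permutation p" using assms by (auto simp: permutation_permutes)
  show "\<forall>i. i \<notin> S \<longrightarrow> f i = 0" if "f \<in> moved_space p"
    using moved_space_outside[OF that p] by blast
  show "\<forall>i\<in>S. sum f (orbit p i) = 0" if "f \<in> moved_space p"
    using sum_moved_space[OF that bij_betw_orbit[OF perm]] by blast
  show "f \<in> moved_space p" if "\<forall>i. i \<notin> S \<longrightarrow> f i = 0" "\<forall>i\<in>S. sum f (orbit p i) = 0"
    using that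
  proof (induction "card {i. f i = 1}" arbitrary: f rule: less_induct)
    case less
    show ?case
    proof (cases "f = 0")
      case True
      then show ?thesis by simp
    next
      case False
      then obtain a where a: "f a = 1" by (auto simp: fun_eq_iff)
      with less.prems have "a \<in> S" by (metis zero_neq_one)
      have self: "a \<in> orbit p a"
        using perm by (rule permutation_self_in_orbit)
      then have fin_orb: "finite (orbit p a)" by (rule finite_orbit)
      have "\<exists>b\<in>orbit p a. b \<noteq> a \<and> f b = 1"
      proof (rule ccontr)
        assume "\<not> ?thesis"
        then have "\<forall>b\<in>orbit p a - {a}. f b = 0" by auto
        then have "sum f (orbit p a) = f a"
          using sum.remove[OF fin_orb self, of f] by simp
        then show False using less.prems(2) \<open>a \<in> S\<close> a by auto
      qed
      then obtain b where b: "b \<in> orbit p a" "b \<noteq> a" "f b = 1" by blast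
      have ab: "delta a + delta b \<in> moved_space p"
        using b(1) permutes_inj[OF p] by (intro delta_orbit_in_moved_space)
      have fin: "finite {i. f i = 1}"
        using less.prems(1) \<open>finite S\<close> by (rule_tac finite_subset[of _ S]) force+
      have "{i. (f + (delta a + delta b)) i = 1} \<subset> {i. f i = 1}"
        using a b by (auto simp: delta_apply)
      then have card: "card {i. (f + (delta a + delta b)) i = 1} < card {i. f i = 1}"
        using fin by (rule psubset_card_mono[rotated])
      have "f + (delta a + delta b) \<in> moved_space p"
      proof (rule less.hyps[OF card])
        show "\<forall>i. i \<notin> S \<longrightarrow> (f + (delta a + delta b)) i = 0"
          using less.prems(1) moved_space_outside[OF ab p] by simp
        show "\<forall>i\<in>S. sum (f + (delta a + delta b)) (orbit p i) = 0"
          using less.prems(2) sum_moved_space[OF ab bij_betw_orbit[OF perm]]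
          by (auto simp: sum.distrib simp del: plus_fun_apply simp: plus_fun_def)
      qed
      from moved_space_add[OF this ab] show ?thesis by (simp add: add.assoc)
    qed
  qed
qed


subsection \<open>Words in transpositions and 3-cycles\<close>

lemma transpose_skip:
  assumes p: "p permutes S" and "finite S" and a: "p a \<noteq> a"
  defines "q \<equiv> transpose a (p a) \<circ> p"
  shows "q permutes S" "q a = a" "p = transpose a (p a) \<circ> q"
    and "moved_space q \<subseteq> moved_space p"
    and "2 * card (moved_space q) \<le> card (moved_space p)"
    and "card {i. q i \<noteq> i} < card {i. p i \<noteq> i}"
proof -
  let ?v = "delta a + delta (p a)"
  have "a \<in> S" using a p by (meson permutes_not_in)
  then have t: "transpose a (p a) permutes S"
    using p by (intro permutes_swap_id) (auto simp: permutes_in_image)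
  show q: "q permutes S" unfolding q_def using p t by (rule permutes_compose)
  show qa: "q a = a" by (simp add: q_def)
  show "p = transpose a (p a) \<circ> q" by (simp add: q_def flip: comp_assoc)
  have v: "?v \<in> moved_space p" using permutes_inj[OF p] by (rule delta_step_in_moved_space)
  show sub: "moved_space q \<subseteq> moved_space p"
  proof
    fix h assume "h \<in> moved_space q"
    then obtain f g where "f \<in> moved_space (transpose a (p a))" "g \<in> moved_space p" "h = f + g"
      unfolding q_def by (rule moved_space_comp)
    moreover from this(1) have "f \<in> moved_space p"
      using moved_space_transpose[of a "p a"] v by auto
    ultimately show "h \<in> moved_space p" by (simp add: moved_space_add)
  qed
  have fin: "finite (moved_space p)" "finite (moved_space q)"
    using p q \<open>finite S\<close> by (auto intro: finite_moved_space)
  have "moved_space q \<inter> (+) ?v ` moved_space q = {}"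
  proof -
    have "(?v + f) a = 1" if "f \<in> moved_space q" for f
      using moved_space_fixpoint[OF that qa] a by (simp add: delta_apply)
    moreover have "f a = 0" if "f \<in> moved_space q" for f
      using that qa by (rule moved_space_fixpoint)
    ultimately show ?thesis by fastforce
  qed
  moreover have "inj_on ((+) ?v) (moved_space q)" by (rule inj_onI) (rule add_left_imp_eq)
  ultimately have "2 * card (moved_space q) = card (moved_space q \<union> (+) ?v ` moved_space q)"
    using fin by (simp add: card_Un_disjoint card_image)
  also have "\<dots> \<le> card (moved_space p)"
    using fin sub v moved_space_add by (intro card_mono) auto
  finally show "2 * card (moved_space q) \<le> card (moved_space p)" .
  have "q i \<noteq> i \<Longrightarrow> p i \<noteq> i" for i
    using a permutes_inj[OF p] by (auto simp: q_def transpose_def inj_eq split: if_splits)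
  then have "{i. q i \<noteq> i} \<subset> {i. p i \<noteq> i}"
    using qa a by blast
  moreover have "finite {i. p i \<noteq> i}"
    using \<open>finite S\<close> p by (rule_tac finite_subset[of _ S]) (auto dest: permutes_not_in)
  ultimately show "card {i. q i \<noteq> i} < card {i. p i \<noteq> i}" by (rule psubset_card_mono[rotated])
qed

lemma transposition_word:
  assumes "p permutes {1..N}"
  shows "\<exists>ts. set ts \<subseteq> transpositions N \<and> foldr (\<circ>) ts id = p \<and> 2 ^ length ts \<le> card (moved_space p)"
  using assms
proof (induction "card {i. p i \<noteq> i}" arbitrary: p rule: less_induct)
  case less
  show ?case
  proof (cases "p = id")
    case True
    then show ?thesis by (intro exI[of _ "[]"]) (simp add: moved_space_id)
  next
    case False
    then obtain a where a: "p a \<noteq> a" by (auto simp: fun_eq_iff)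
    let ?q = "transpose a (p a) \<circ> p"
    note skip = transpose_skip[OF less.prems finite_atLeastAtMost a]
    obtain ts where ts: "set ts \<subseteq> transpositions N" "foldr (\<circ>) ts id = ?q"
      "2 ^ length ts \<le> card (moved_space ?q)"
      using less.hyps[OF skip(6) skip(1)] by auto
    have "a \<in> {1..N}" using a less.prems by (meson permutes_not_in)
    moreover from this have "p a \<in> {1..N}" using permutes_in_image[OF less.prems] by blast
    ultimately have "transpose a (p a) \<in> transpositions N"
      using a[symmetric] unfolding transpositions_def by blast
    then show ?thesis
      using ts skip(3,5) by (intro exI[of _ "transpose a (p a) # ts"]) auto
  qed
qed

lemma foldr_comp_permutes:
  assumes "\<forall>t\<in>set ts. t permutes S" shows "foldr (\<circ>) ts id permutes S"
  using assms by (induction ts) (auto simp: permutes_id intro: permutes_compose)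

lemma card_moved_space_word:
  assumes "\<forall>t\<in>set ts. t permutes S \<and> card (moved_space t) \<le> m" "finite S"
  shows "card (moved_space (foldr (\<circ>) ts id)) \<le> m ^ length ts"
  using assms(1)
proof (induction ts)
  case Nil
  then show ?case by (simp add: moved_space_id[unfolded id_def])
next
  case (Cons t ts)
  have "card (moved_space (t \<circ> foldr (\<circ>) ts id)) \<le> card (moved_space t) * card (moved_space (foldr (\<circ>) ts id))"
    using Cons.prems assms(2) by (intro card_moved_space_comp[of _ S] foldr_comp_permutes) auto
  also have "\<dots> \<le> m * m ^ length ts"
    using Cons.prems by (intro mult_mono Cons.IH) simp_all
  finally show ?case unfolding foldr.simps comp_apply list.size by simp
qed

lemma transposition_permutes: "t \<in> transpositions N \<Longrightarrow> t permutes {1..N}"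
  by (auto simp: transpositions_def intro: permutes_swap_id)

lemma card_moved_space_transposition: "t \<in> transpositions N \<Longrightarrow> card (moved_space t) \<le> 2"
  by (auto simp: transpositions_def card_moved_space_transpose)

lemma three_cycleE:
  assumes "t \<in> three_cycles N"
  obtains a b c where "t = transpose a b \<circ> transpose b c" "a \<noteq> b" "b \<noteq> c" "a \<noteq> c" "{a, b, c} \<subseteq> {1..N}"
proof -
  obtain cs where cs: "t = cycle_of_list cs" "distinct cs" "length cs = 3" "set cs \<subseteq> {1..N}"
    using assms by auto
  then obtain a b c where "cs = [a, b, c]" using stupid_lemma by blast
  with cs show thesis by (intro that[of a b c]) auto
qed

lemma three_cycleI:
  assumes "a \<noteq> b" "b \<noteq> c" "a \<noteq> c" "{a, b, c} \<subseteq> {1..N}"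
  shows "transpose a b \<circ> transpose b c \<in> three_cycles N"
  using assms by (intro CollectI exI[of _ "[a, b, c]"]) auto

lemma three_cycle_permutes: "t \<in> three_cycles N \<Longrightarrow> t permutes {1..N}"
  using three_cycles_incl[of N] by (auto simp: alt_group_carrier)

lemma card_moved_space_three_cycle:
  assumes "t \<in> three_cycles N" shows "card (moved_space t) \<le> 4"
proof -
  obtain a b c where t: "t = transpose a b \<circ> transpose b c" "{a, b, c} \<subseteq> {1..N}"
    using assms by (rule three_cycleE)
  have "card (moved_space t) \<le> card (moved_space (transpose a b)) * card (moved_space (transpose b c))"
    unfolding t(1) using t(2) by (intro card_moved_space_comp[of _ "{1..N}"] permutes_swap_id) auto
  also have "\<dots> \<le> 2 * 2" by (intro mult_mono card_moved_space_transpose) auto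
  finally show ?thesis by simp
qed

lemma in_orbit_if_moved_space_subset:
  assumes "moved_space q \<subseteq> moved_space p" "inj q" "permutation p"
  shows "q i \<in> orbit p i"
proof (rule ccontr)
  assume not_in: "q i \<notin> orbit p i"
  have "delta i + delta (q i) \<in> moved_space p"
    using delta_step_in_moved_space[OF assms(2)] assms(1) by blast
  then have "(\<Sum>j\<in>orbit p i. delta i j + delta (q i) j) = 0"
    using sum_moved_space[OF _ bij_betw_orbit[OF assms(3)]] by (simp add: plus_fun_def)
  moreover have "i \<in> orbit p i" "finite (orbit p i)"
    using permutation_self_in_orbit[OF assms(3)] finite_orbit[of i p] by simp_all
  ultimately show False using not_in by (simp add: sum.distrib delta_def)
qed

lemma invariant_on_orbit:
  assumes "f \<circ> p = f" "j \<in> orbit p i" shows "f j = f i"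
  using assms(2) by induction (use assms(1) in \<open>auto simp: fun_eq_iff\<close>)

lemma sum_orbit_invariant:
  fixes f :: "'a \<Rightarrow> bit"
  assumes "f \<circ> p = f" "odd (card (orbit p i))"
  shows "sum f (orbit p i) = f i"
proof -
  have "sum f (orbit p i) = of_nat (card (orbit p i)) * f i"
    using invariant_on_orbit[OF assms(1)] by simp
  moreover have "(of_nat (card (orbit p i)) :: bit) = 1"
    using assms(2) of_nat_bit_eq_0_iff[of "card (orbit p i)"] by auto
  ultimately show ?thesis by simp
qed

lemma odd_orbits_iff_moved_space_nondegenerate:
  assumes p: "p permutes S" and "finite S"
  shows "(\<forall>i\<in>S. odd (card (orbit p i))) \<longleftrightarrow> (\<forall>f\<in>moved_space p. f \<circ> p = f \<longrightarrow> f = 0)"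
    (is "?odd \<longleftrightarrow> ?nondeg")
proof
  have perm: "permutation p" using assms by (auto simp: permutation_permutes)
  show ?nondeg if odd: ?odd
  proof (intro ballI impI ext)
    fix f i assume f: "f \<in> moved_space p" "f \<circ> p = f"
    show "f i = 0 i"
    proof (cases "i \<in> S")
      case True
      have "f i = sum f (orbit p i)"
        using f(2) odd True by (simp add: sum_orbit_invariant)
      also have "\<dots> = 0"
        using f(1) bij_betw_orbit[OF perm] by (rule sum_moved_space)
      finally show ?thesis by simp
    next
      case False
      with f(1) p show ?thesis by (simp add: moved_space_outside)
    qed
  qed
  show ?odd if nondeg: ?nondeg
  proof (rule ballI, rule ccontr)
    fix i assume i: "i \<in> S" and even: "\<not> odd (card (orbit p i))"
    let ?f = "\<lambda>j. of_bool (j \<in> orbit p i) :: bit"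
    have fin: "finite (orbit p j)" for j
      using perm by (intro finite_orbit permutation_self_in_orbit)
    have "?f \<in> moved_space p"
      unfolding moved_space_iff_sum_orbit[OF assms]
    proof (intro conjI allI impI ballI)
      fix j assume "j \<notin> S"
      then show "?f j = 0" using permutes_orbit_subset[OF p i] by auto
    next
      fix j assume "j \<in> S"
      have "orbit p j \<inter> orbit p i = {} \<or> orbit p j = orbit p i"
        using cyclic_on_orbit'[OF perm] orbit_cyclic_eq3 by (metis disjoint_iff)
      then have "card (orbit p j \<inter> orbit p i) = 0 \<or> card (orbit p j \<inter> orbit p i) = card (orbit p i)"
        by (metis card.empty inf.idem)
      then have "even (card {k \<in> orbit p j. k \<in> orbit p i})"
        using even by (auto simp: Int_def)
      then show "sum ?f (orbit p j) = 0"
        using sum_bit_eq_card[OF fin] of_nat_bit_eq_0_iff by metis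
    qed
    moreover have "?f \<circ> p = ?f"
    proof
      fix j
      have "p j \<in> orbit p i \<longleftrightarrow> j \<in> orbit p i"
        using permutation_self_in_orbit[OF perm] permutation_orbit_step[OF perm]
          cyclic_on_orbit'[OF perm] orbit_cyclic_eq3 by (metis orbit.step)
      then show "(?f \<circ> p) j = ?f j" by simp
    qed
    ultimately have "?f = 0" using nondeg by blast
    then have "?f i = 0" by (metis zero_fun_apply)
    then show False using permutation_self_in_orbit[OF perm, of i] by simp
  qed
qed


lemma three_cycle_word:
  assumes "p permutes {1..N}" "\<forall>f\<in>moved_space p. f \<circ> p = f \<longrightarrow> f = 0"
  shows "\<exists>ts. set ts \<subseteq> three_cycles N \<and> foldr (\<circ>) ts id = p \<and> 4 ^ length ts \<le> card (moved_space p)"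
  using assms
proof (induction "card {i. p i \<noteq> i}" arbitrary: p rule: less_induct)
  case less
  note p = less.prems(1) and nondeg = less.prems(2)
  show ?case
  proof (cases "p = id")
    case True
    then show ?thesis by (intro exI[of _ "[]"]) (simp add: moved_space_id)
  next
    case False
    then obtain a where a: "p a \<noteq> a" by (auto simp: fun_eq_iff)
    define b d where "b = p a" and "d = p b"
    have inj: "p i = p j \<longleftrightarrow> i = j" for i j using permutes_inj[OF p] by (simp add: inj_eq)
    have "d \<noteq> b" using a by (simp add: b_def d_def inj)
    have "d \<noteq> a"
    proof
      assume "d = a"
      then have "(delta a + delta b) \<circ> p = delta a + delta b"
        by (auto simp: fun_eq_iff delta_apply b_def d_def inj)
      moreover have "delta a + delta b \<in> moved_space p"
        unfolding b_def using permutes_inj[OF p] by (rule delta_step_in_moved_space)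
      ultimately have "delta a + delta b = 0" using nondeg by blast
      then have "(delta a + delta b) a = 0" by (metis zero_fun_apply)
      then show False using a by (simp add: delta_apply b_def)
    qed
    define r where "r = transpose a b \<circ> p"
    have rb: "r b = d" using \<open>d \<noteq> a\<close> \<open>d \<noteq> b\<close> by (simp add: r_def d_def[symmetric])
    define q where "q = transpose b d \<circ> r"
    note skip1 = transpose_skip[OF p finite_atLeastAtMost a, folded b_def, folded r_def]
    have "r b \<noteq> b" using rb \<open>d \<noteq> b\<close> by simp
    note skip2 = transpose_skip[OF skip1(1) finite_atLeastAtMost this, unfolded rb, folded q_def]
    have qa: "q a = a" using skip1(2) \<open>d \<noteq> a\<close> a by (simp add: q_def b_def)
    have nondeg': "f = 0" if f: "f \<in> moved_space q" "f \<circ> q = f" for f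
    proof -
      have fq: "f (q i) = f i" for i using f(2) by (simp add: fun_eq_iff)
      have fa: "f a = 0" "f b = 0" using f(1) qa skip2(2) by (auto intro: moved_space_fixpoint)
      define h where "h = (if f d = 0 then f else f + (delta a + delta b))"
      have h: "h i = (if i = a \<or> i = b then f d else f i)" for i
        using fa a by (cases "f d") (auto simp: h_def delta_apply b_def)
      have "f \<in> moved_space p" using f(1) skip1(4) skip2(4) by blast
      moreover have "delta a + delta b \<in> moved_space p"
        unfolding b_def using permutes_inj[OF p] by (rule delta_step_in_moved_space)
      ultimately have "h \<in> moved_space p" by (simp add: h_def moved_space_add)
      moreover have "h (p i) = h i" for i
      proof -
        consider "i = a" | "i = b" | "i \<noteq> a" "i \<noteq> b" "p i = a" | "i \<noteq> a" "i \<noteq> b" "p i \<noteq> a"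
          by blast
        then show ?thesis
        proof cases
          case 1
          then show ?thesis by (simp add: h flip: b_def)
        next
          case 2
          then show ?thesis using \<open>d \<noteq> a\<close> \<open>d \<noteq> b\<close> by (simp add: h flip: d_def)
        next
          case 3
          then have "q i = d" by (simp add: q_def r_def)
          then show ?thesis using 3 fq[of i] by (simp add: h)
        next
          case 4
          then have "p i \<noteq> b" "p i \<noteq> d" by (auto simp: b_def d_def inj)
          moreover from this 4 have "q i = p i" by (simp add: q_def r_def)
          ultimately show ?thesis using 4 fq[of i] by (simp add: h)
        qed
      qed
      ultimately have "h = 0" using nondeg by (auto simp: fun_eq_iff)
      then have "h i = 0" for i by simp
      from this[of d] this show ?thesis
        using fa \<open>d \<noteq> a\<close> \<open>d \<noteq> b\<close> by (auto simp: fun_eq_iff h split: if_splits) metis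
    qed
    have "card {i. q i \<noteq> i} < card {i. p i \<noteq> i}" using skip1(6) skip2(6) by simp
    from less.hyps[OF this skip2(1)] nondeg' obtain ts where
      ts: "set ts \<subseteq> three_cycles N" "foldr (\<circ>) ts id = q" "4 ^ length ts \<le> card (moved_space q)"
      by blast
    have "a \<in> {1..N}" using a p by (meson permutes_not_in)
    moreover from this have "b \<in> {1..N}" using permutes_in_image[OF p] b_def by blast
    moreover from this have "d \<in> {1..N}" using permutes_in_image[OF p] d_def by blast
    ultimately have "transpose a b \<circ> transpose b d \<in> three_cycles N"
      using a \<open>d \<noteq> a\<close> \<open>d \<noteq> b\<close> by (intro three_cycleI) (auto simp: b_def)
    moreover have "(transpose a b \<circ> transpose b d) \<circ> q = p"
      using skip1(3) skip2(3) by (simp add: comp_assoc)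
    ultimately show ?thesis
      using ts skip1(5) skip2(5)
      by (intro exI[of _ "(transpose a b \<circ> transpose b d) # ts"]) auto
  qed
qed

lemma three_cycle_word_odd_orbits:
  assumes "set ts \<subseteq> three_cycles N" "card (moved_space (foldr (\<circ>) ts id)) = 4 ^ length ts"
  shows "\<forall>i\<in>{1..N}. odd (card (orbit (foldr (\<circ>) ts id) i))"
  using assms
proof (induction ts)
  case Nil
  have "orbit id i = {i}" for i :: nat by (simp add: orbit_eq_singleton_iff)
  then show ?case by (simp flip: id_def)
next
  case (Cons t ts)
  define q where "q = foldr (\<circ>) ts id"
  have t: "t \<in> three_cycles N" and ts: "set ts \<subseteq> three_cycles N" using Cons.prems by auto
  have t_perm: "t permutes {1..N}" using t by (rule three_cycle_permutes)
  have q: "q permutes {1..N}"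
    unfolding q_def using ts three_cycle_permutes by (intro foldr_comp_permutes) blast
  have p: "t \<circ> q permutes {1..N}" using q t_perm by (rule permutes_compose)
  have card_p: "card (moved_space (t \<circ> q)) = 4 * 4 ^ length ts"
    using Cons.prems(2) unfolding q_def foldr.simps comp_apply by simp
  have card_t: "card (moved_space t) \<le> 4" using t by (rule card_moved_space_three_cycle)
  have card_q: "card (moved_space q) \<le> 4 ^ length ts"
    unfolding q_def using ts three_cycle_permutes card_moved_space_three_cycle
    by (intro card_moved_space_word[of _ "{1..N}"]) blast+
  have le: "card (moved_space (t \<circ> q)) \<le> card (moved_space t) * card (moved_space q)"
    using t_perm q by (rule card_moved_space_comp) simp
  have card_q_eq: "card (moved_space q) = 4 ^ length ts"
  proof -
    have "4 * 4 ^ length ts \<le> card (moved_space t) * card (moved_space q)"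
      using le card_p by simp
    also have "\<dots> \<le> 4 * card (moved_space q)" using card_t by (rule mult_le_mono1)
    finally show ?thesis using card_q by simp
  qed
  have card_eq: "card (moved_space (t \<circ> q)) = card (moved_space t) * card (moved_space q)"
    unfolding card_p using mult_le_mono[OF card_t card_q] le[unfolded card_p] by (rule antisym[rotated])
  have odd: "\<forall>i\<in>{1..N}. odd (card (orbit q i))"
    unfolding q_def using Cons.IH[OF ts card_q_eq[unfolded q_def]] .
  have nondeg_q: "\<forall>f\<in>moved_space q. f \<circ> q = f \<longrightarrow> f = 0"
    using odd odd_orbits_iff_moved_space_nondegenerate[OF q] by simp
  have perm: "permutation q" using q by (auto simp: permutation_permutes)
  note disj = moved_space_disjoint[OF t_perm q finite_atLeastAtMost card_eq]
  obtain a b c where abc: "t = transpose a b \<circ> transpose b c" "a \<noteq> b" "b \<noteq> c" "a \<noteq> c"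
    "{a, b, c} \<subseteq> {1..N}"
    using t by (rule three_cycleE)
  have t_app: "t a = b" "t b = c" "t c = a" using abc by (auto simp: transpose_def)
  have t_fix: "t i = i" if "i \<notin> {a, b, c}" for i using that by (auto simp: abc transpose_def)
  have nondeg: "f = 0" if f: "f \<in> moved_space (t \<circ> q)" "f \<circ> (t \<circ> q) = f" for f
  proof -
    have p_perm: "permutation (t \<circ> q)" using p by (auto simp: permutation_permutes)
    have "f (t i) = f i" for i
      using moved_space_left_subset[OF t_perm q finite_atLeastAtMost card_eq]
        permutes_inj[OF t_perm] p_perm
      by (intro invariant_on_orbit[OF f(2)] in_orbit_if_moved_space_subset)
    from this[of a] this[of b] have f_abc: "f b = f a" "f c = f a" by (simp_all add: t_app)
    have "f (q i) = f i" for i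
      using moved_space_right_subset[OF t_perm q finite_atLeastAtMost card_eq]
        permutes_inj[OF q] p_perm
      by (intro invariant_on_orbit[OF f(2)] in_orbit_if_moved_space_subset)
    then have fq: "f \<circ> q = f" by (simp add: fun_eq_iff)
    obtain m g where m: "m \<in> moved_space t" and g: "g \<in> moved_space q" and f_eq: "f = m + g"
      using f(1) by (rule moved_space_comp)
    have m_outside: "m i = 0" if "i \<notin> {a, b, c}" for i
      using m t_fix[OF that] by (rule moved_space_fixpoint)
    have delta_t: "delta i + delta j \<in> moved_space t" if "i \<in> {a, b, c}" "j \<in> {a, b, c}" for i j
      using that delta_step_in_moved_space[OF permutes_inj[OF t_perm], of a]
        delta_step_in_moved_space[OF permutes_inj[OF t_perm], of b]
        delta_step_in_moved_space[OF permutes_inj[OF t_perm], of c]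
      by (auto simp: t_app add.commute)
    have m_eq: "m i = f i" if i: "i \<in> {a, b, c}" for i
    proof -
      have fin: "finite (orbit q i)" and self: "i \<in> orbit q i"
        using perm by (auto intro: finite_orbit permutation_self_in_orbit)
      have "m j = 0" if "j \<in> orbit q i - {i}" for j
      proof (cases "j \<in> {a, b, c}")
        case True
        have "delta i + delta j \<in> moved_space q"
          using that permutes_inj[OF q] by (intro delta_orbit_in_moved_space) auto
        then have "delta i + delta j = 0" using delta_t[OF i True] disj by blast
        then have "(delta i + delta j) i = 0" by (metis zero_fun_apply)
        then show ?thesis using that by (simp add: delta_apply split: if_splits)
      qed (rule m_outside)
      then have "m i = sum m (orbit q i)" using sum.remove[OF fin self, of m] by simp
      also have "\<dots> = sum m (orbit q i) + sum g (orbit q i)"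
        using sum_moved_space[OF g bij_betw_orbit[OF perm]] by simp
      also have "\<dots> = sum f (orbit q i)" by (simp add: f_eq sum.distrib)
      also have "\<dots> = f i" using fq odd i abc(5) by (intro sum_orbit_invariant) auto
      finally show ?thesis .
    qed
    have "t ` {a, b, c} = {a, b, c}" unfolding image_insert image_empty t_app by blast
    then have "bij_betw t {a, b, c} {a, b, c}"
      using inj_on_subset[OF permutes_inj[OF t_perm] subset_UNIV] unfolding bij_betw_def by blast
    from sum_moved_space[OF m this] have "m a + (m b + m c) = 0" using abc(2-4) by simp
    then have "f a = 0" by (simp add: m_eq f_abc)
    then have "m i = 0" for i
      using m_eq[of i] m_outside[of i] f_abc by (cases "i \<in> {a, b, c}") auto
    then have "f = g" by (simp add: f_eq fun_eq_iff)
    then show ?thesis using nondeg_q g fq by blast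
  qed
  have "\<forall>i\<in>{1..N}. odd (card (orbit (t \<circ> q) i))"
    using nondeg odd_orbits_iff_moved_space_nondegenerate[OF p] by blast
  then show ?case unfolding q_def foldr.simps comp_apply .
qed


subsection \<open>Even cycles and the sign\<close>

lemma evenperm_cycle:
  assumes "distinct cs" "cs \<noteq> []" shows "evenperm (cycle_of_list cs) \<longleftrightarrow> odd (length cs)"
  using assms
proof (induction cs rule: cycle_of_list.induct)
  case (1 i j cs)
  then have "evenperm (cycle_of_list (j # cs)) \<longleftrightarrow> odd (length (j # cs))" by simp
  then have "evenperm (transpose i j \<circ> cycle_of_list (j # cs)) \<longleftrightarrow> odd (length (i # j # cs))"
    using 1(2) by (simp add: evenperm_comp permutation_swap_id permutation_of_cycle evenperm_swap)
  then show ?case unfolding cycle_of_list.simps .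
qed auto

lemma orbit_cycle:
  assumes "distinct cs" "i \<in> set cs" shows "orbit (cycle_of_list cs) i = set cs"
proof
  show "orbit (cycle_of_list cs) i \<subseteq> set cs"
    using cycle_permutes assms(2) by (rule permutes_orbit_subset)
  show "set cs \<subseteq> orbit (cycle_of_list cs) i"
  proof
    fix j assume "j \<in> set cs"
    then obtain k l where kl: "k < length cs" "cs ! k = i" "l < length cs" "cs ! l = j"
      using assms(2) by (meson in_set_conv_nth)
    define n where "n = (l + length cs - k)"
    have "(cycle_of_list cs ^^ n) i = map (cycle_of_list cs ^^ n) cs ! k" using kl by simp
    also have "\<dots> = rotate n cs ! k" by (simp add: cyclic_rotation[OF assms(1)])
    also have "\<dots> = cs ! ((n + k) mod length cs)" using kl by (simp add: nth_rotate add.commute)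
    also have "(n + k) mod length cs = l" using kl by (simp add: n_def)
    finally show "j \<in> orbit (cycle_of_list cs) i"
      unfolding orbit_altdef_permutation[OF permutation_of_cycle] using kl by auto
  qed
qed

definition even_orbit_reps :: "(nat \<Rightarrow> nat) \<Rightarrow> nat set \<Rightarrow> nat set" where
  "even_orbit_reps p S = {i \<in> S. Min (orbit p i) = i \<and> even (card (orbit p i))}"

lemma even_orbit_reps_empty:
  assumes "\<forall>i\<in>S. odd (card (orbit p i))" "C \<subseteq> S"
  shows "even_orbit_reps p C = {}"
  using assms by (auto simp: even_orbit_reps_def)

lemma evenperm_iff_even_orbits:
  fixes p :: "nat \<Rightarrow> nat"
  assumes "p permutes S" "finite S"
  shows "evenperm p \<longleftrightarrow> even (card (even_orbit_reps p S))"
proof -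
  let ?E = "\<lambda>S p. {i \<in> S. Min (orbit p i) = i \<and> even (card (orbit p i))}"
  have "p permutes S \<and> (evenperm p \<longleftrightarrow> even (card (?E S p)))"
    if "cycle_decomp S p" "finite S" for S and p :: "nat \<Rightarrow> nat"
    using that
  proof induction
    case empty
    then show ?case by (auto simp: permutes_id)
  next
    case (comp I p cs)
    then have p: "p permutes I" and even_p: "evenperm p \<longleftrightarrow> even (card (?E I p))" and fin: "finite I"
      by auto
    let ?c = "cycle_of_list cs"
    have c: "?c permutes set cs" by (rule cycle_permutes)
    have perm: "?c \<circ> p permutes set cs \<union> I"
      using p c by (intro permutes_compose) (auto intro: permutes_subset)
    show ?case
    proof (cases "cs = []")
      case True
      with p even_p show ?thesis by simp
    next
      case False
      have ev: "evenperm (?c \<circ> p) \<longleftrightarrow> (odd (length cs) \<longleftrightarrow> evenperm p)"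
        using evenperm_comp[OF permutation_of_cycle, of p cs] p fin evenperm_cycle[OF comp(2) False]
        by (auto simp: permutation_permutes)
      have orbit_I: "orbit (?c \<circ> p) i = orbit p i" if "i \<in> I" for i
      proof (rule orbit_cong)
        show "i \<in> orbit p i"
          using p fin by (intro permutation_self_in_orbit) (auto simp: permutation_permutes)
        fix j assume "j \<in> orbit p i"
        then have "p j \<in> I" using permutes_orbit_subset[OF p that] orbit.step by fast
        then show "(?c \<circ> p) j = p j" using comp(3) by (auto intro: id_outside_supp)
      qed
      have orbit_cs: "orbit (?c \<circ> p) i = set cs" if "i \<in> set cs" for i
      proof -
        have "orbit (?c \<circ> p) i = orbit ?c i"
        proof (rule orbit_cong)
          show "i \<in> orbit ?c i" using permutation_of_cycle by (rule permutation_self_in_orbit)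
          fix j assume "j \<in> orbit ?c i"
          then have "j \<notin> I" using permutes_orbit_subset[OF c that] comp(3) by fast
          then show "(?c \<circ> p) j = ?c j" using p by (simp add: permutes_not_in)
        qed
        then show ?thesis using orbit_cycle[OF comp(2) that] by simp
      qed
      have "?E (set cs \<union> I) (?c \<circ> p)
          = ?E I p \<union> {i \<in> set cs. Min (set cs) = i \<and> even (card (set cs))}" (is "_ = _ \<union> ?F")
        using orbit_I orbit_cs by auto
      moreover have "?F = (if even (length cs) then {Min (set cs)} else {})"
        using False Min_in[of "set cs"] distinct_card[OF comp(2)] by auto
      moreover have "card (?E I p \<union> ?F) = card (?E I p) + card ?F"
        using fin comp(3) by (intro card_Un_disjoint) auto
      ultimately have "card (?E (set cs \<union> I) (?c \<circ> p)) = card (?E I p) + (if even (length cs) then 1 else 0)"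
        by simp
      then have "evenperm (?c \<circ> p) \<longleftrightarrow> even (card (?E (set cs \<union> I) (?c \<circ> p)))"
        using ev even_p by (cases "even (length cs)") simp_all
      with perm show ?thesis by (rule conjI)
    qed
  qed
  then show ?thesis unfolding even_orbit_reps_def using cycle_decomposition[OF assms] assms(2) by blast
qed

lemma even_orbits_parity_eq:
  fixes p q :: "nat \<Rightarrow> nat"
  assumes p: "p permutes S" and q: "q permutes S" and "finite S"
    and C: "C \<subseteq> S" "p ` C \<subseteq> C" "q ` C \<subseteq> C"
    and odd_pq: "\<forall>i\<in>S. odd (card (orbit (p \<circ> q) i))"
  shows "even (card (even_orbit_reps p C)) \<longleftrightarrow>
    even (card (even_orbit_reps q C))"
proof -
  have fin: "finite C" using C(1) \<open>finite S\<close> by (rule finite_subset)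
  have restr: "restrict_id r C permutes C" "permutation (restrict_id r C)"
    "evenperm (restrict_id r C) \<longleftrightarrow> even (card (even_orbit_reps r C))"
    if r: "r permutes S" "r ` C \<subseteq> C" for r
  proof -
    have "bij_betw r C C"
      using r fin permutes_inj[OF r(1)] by (metis bij_betw_def endo_inj_surj inj_on_subset subset_UNIV)
    then show rC: "restrict_id r C permutes C" by (rule permutes_restrict_id)
    then show "permutation (restrict_id r C)" using fin by (auto simp: permutation_permutes)
    have orbit_eq: "orbit (restrict_id r C) i = orbit r i" if "i \<in> C" for i
      using that r(2) by (intro orbit_cong0[of _ C]) auto
    have "even_orbit_reps (restrict_id r C) C = even_orbit_reps r C"
      unfolding even_orbit_reps_def by (intro Collect_cong conj_cong refl) (simp_all add: orbit_eq)
    then show "evenperm (restrict_id r C) \<longleftrightarrow> even (card (even_orbit_reps r C))"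
      unfolding evenperm_iff_even_orbits[OF rC fin] by simp
  qed
  have pq: "p \<circ> q permutes S" "(p \<circ> q) ` C \<subseteq> C"
    using p q C by (blast intro: permutes_compose, auto simp: image_subset_iff)
  have "even_orbit_reps (p \<circ> q) C = {}"
    using odd_pq C(1) by (rule even_orbit_reps_empty)
  then have "evenperm (restrict_id (p \<circ> q) C)" unfolding restr(3)[OF pq] by simp
  moreover have "restrict_id (p \<circ> q) C = restrict_id p C \<circ> restrict_id q C"
    using C(3) by (auto simp: fun_eq_iff restrict_id_def)
  ultimately have "evenperm (restrict_id p C) \<longleftrightarrow> evenperm (restrict_id q C)"
    using evenperm_comp[OF restr(2)[OF p C(2)] restr(2)[OF q C(3)]] by metis
  then show ?thesis unfolding restr(3)[OF p C(2)] restr(3)[OF q C(3)] .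
qed


subsection \<open>Oddness of the middle factor\<close>

lemma odd_orbits_middle_factor:
  fixes y w v :: "nat \<Rightarrow> nat"
  assumes y: "y permutes S" and w: "w permutes S" and v: "v permutes S" and "finite S"
    and card_yw: "card (moved_space (y \<circ> w)) = card (moved_space y) * card (moved_space w)"
    and card_wv: "card (moved_space (w \<circ> v)) = card (moved_space w) * card (moved_space v)"
    and card_ywv: "card (moved_space (y \<circ> (w \<circ> v))) = card (moved_space y) * card (moved_space (w \<circ> v))"
    and odd_y: "\<forall>i\<in>S. odd (card (orbit y i))" and odd_v: "\<forall>i\<in>S. odd (card (orbit v i))"
    and odd_yw: "\<forall>i\<in>S. odd (card (orbit (y \<circ> w) i))"
    and odd_wv: "\<forall>i\<in>S. odd (card (orbit (w \<circ> v) i))"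
  shows "\<forall>i\<in>S. odd (card (orbit w i))"
proof (intro ballI notI)
  define g :: "nat \<Rightarrow> bit" where "g = (\<lambda>i. of_bool (i \<in> even_orbit_reps w S))"
  have yw: "y \<circ> w permutes S" and wv: "w \<circ> v permutes S"
    using y w v by (auto intro: permutes_compose)
  have sum_g: "sum g C = of_nat (card (even_orbit_reps w C))" if "C \<subseteq> S" for C
  proof -
    have "sum g C = of_nat (card {i \<in> C. i \<in> even_orbit_reps w S})"
      unfolding g_def using finite_subset[OF that \<open>finite S\<close>] by (rule sum_bit_eq_card)
    also have "{i \<in> C. i \<in> even_orbit_reps w S} = even_orbit_reps w C"
      using that by (auto simp: even_orbit_reps_def)
    finally show ?thesis .
  qed
  have orbit_closed: "q ` orbit p i \<subseteq> orbit p i"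
    if "p permutes S" "q permutes S" "moved_space q \<subseteq> moved_space p" for p q i
  proof -
    have "permutation p" using that(1) \<open>finite S\<close> by (auto simp: permutation_permutes)
    then show ?thesis
      using in_orbit_if_moved_space_subset[OF that(3) permutes_inj[OF that(2)]] orbit_trans by fast
  qed
  have g_yw: "g \<in> moved_space (y \<circ> w)"
    unfolding moved_space_iff_sum_orbit[OF yw \<open>finite S\<close>]
  proof (intro conjI allI impI ballI)
    fix i assume "i \<in> S"
    let ?C = "orbit (y \<circ> w) i"
    have C: "?C \<subseteq> S" using yw \<open>i \<in> S\<close> by (rule permutes_orbit_subset)
    have "even_orbit_reps y ?C = {}" using odd_y C by (rule even_orbit_reps_empty)
    moreover note even_orbits_parity_eq[OF y w \<open>finite S\<close> C
      orbit_closed[OF yw y moved_space_left_subset[OF y w \<open>finite S\<close> card_yw]]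
      orbit_closed[OF yw w moved_space_right_subset[OF y w \<open>finite S\<close> card_yw]] odd_yw]
    ultimately have "even (card (even_orbit_reps w ?C))" by simp
    then show "sum g ?C = 0" unfolding sum_g[OF C] of_nat_bit_eq_0_iff .
  qed (simp add: g_def even_orbit_reps_def)
  have g_wv: "g \<in> moved_space (w \<circ> v)"
    unfolding moved_space_iff_sum_orbit[OF wv \<open>finite S\<close>]
  proof (intro conjI allI impI ballI)
    fix i assume "i \<in> S"
    let ?C = "orbit (w \<circ> v) i"
    have C: "?C \<subseteq> S" using wv \<open>i \<in> S\<close> by (rule permutes_orbit_subset)
    have "even_orbit_reps v ?C = {}" using odd_v C by (rule even_orbit_reps_empty)
    moreover note even_orbits_parity_eq[OF w v \<open>finite S\<close> C
      orbit_closed[OF wv w moved_space_left_subset[OF w v \<open>finite S\<close> card_wv]]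
      orbit_closed[OF wv v moved_space_right_subset[OF w v \<open>finite S\<close> card_wv]] odd_wv]
    ultimately have "even (card (even_orbit_reps w ?C))" by simp
    then show "sum g ?C = 0" unfolding sum_g[OF C] of_nat_bit_eq_0_iff .
  qed (simp add: g_def even_orbit_reps_def)
  obtain f h where f: "f \<in> moved_space y" and h: "h \<in> moved_space w" and g_eq: "g = f + h"
    using g_yw by (rule moved_space_comp)
  have "h \<in> moved_space (w \<circ> v)"
    using h moved_space_left_subset[OF w v \<open>finite S\<close> card_wv] by blast
  then have "g + h \<in> moved_space (w \<circ> v)" by (rule moved_space_add[OF g_wv])
  then have "f \<in> moved_space (w \<circ> v)" by (simp add: g_eq add.assoc)
  then have "f = 0" using f moved_space_disjoint[OF y wv \<open>finite S\<close> card_ywv] by blast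
  then have g_w: "g \<in> moved_space w" using h by (simp add: g_eq)
  have perm: "permutation w" using w \<open>finite S\<close> by (auto simp: permutation_permutes)
  fix i assume "i \<in> S" and even: "even (card (orbit w i))"
  let ?C = "orbit w i"
  have orbit_eq: "orbit w j = ?C" if "j \<in> ?C" for j
    using cyclic_on_orbit'[OF perm] that by (rule orbit_cyclic_eq3)
  have "finite ?C" using perm by (intro finite_orbit permutation_self_in_orbit)
  then have "Min ?C \<in> ?C" using orbit_nonempty by (rule Min_in)
  then have "even_orbit_reps w ?C = {Min ?C}"
    using orbit_eq even by (auto simp: even_orbit_reps_def)
  then have "sum g ?C = 1" using sum_g[OF permutes_orbit_subset[OF w \<open>i \<in> S\<close>]] by simp
  moreover have "sum g ?C = 0" using g_w bij_betw_orbit[OF perm] by (rule sum_moved_space)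
  ultimately show False by simp
qed

subsection \<open>Lengths\<close>

lemma gen_length_le:
  assumes "set ts \<subseteq> T" "foldr (\<otimes>\<^bsub>G\<^esub>) ts \<one>\<^bsub>G\<^esub> = x"
  shows "gen_length G T x \<le> length ts"
  unfolding gen_length_def by (rule Least_le) (use assms in blast)

lemma gen_length_word:
  assumes "set ts \<subseteq> T" "foldr (\<otimes>\<^bsub>G\<^esub>) ts \<one>\<^bsub>G\<^esub> = x"
  obtains us where "set us \<subseteq> T" "foldr (\<otimes>\<^bsub>G\<^esub>) us \<one>\<^bsub>G\<^esub> = x" "length us = gen_length G T x"
proof -
  have "\<exists>us. length us = gen_length G T x \<and> set us \<subseteq> T \<and> foldr (\<otimes>\<^bsub>G\<^esub>) us \<one>\<^bsub>G\<^esub> = x"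
    unfolding gen_length_def by (rule LeastI_ex) (use assms in blast)
  then show thesis using that by blast
qed

abbreviation length2 :: "nat \<Rightarrow> (nat \<Rightarrow> nat) \<Rightarrow> nat" where
  "length2 N \<equiv> gen_length (sym_group N) (transpositions N)"

abbreviation length3 :: "nat \<Rightarrow> (nat \<Rightarrow> nat) \<Rightarrow> nat" where
  "length3 N \<equiv> gen_length (alt_group N) (three_cycles N)"

lemma card_moved_space_eq_length2:
  assumes "p permutes {1..N}"
  shows "card (moved_space p) = 2 ^ length2 N p"
proof (rule antisym)
  obtain ts where ts: "set ts \<subseteq> transpositions N" "foldr (\<circ>) ts id = p"
    "2 ^ length ts \<le> card (moved_space p)"
    using transposition_word[OF assms] by blast
  then have word: "foldr (\<otimes>\<^bsub>sym_group N\<^esub>) ts \<one>\<^bsub>sym_group N\<^esub> = p"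
    by (simp add: sym_group_mult sym_group_one)
  obtain us where us: "set us \<subseteq> transpositions N" "foldr (\<circ>) us id = p" "length us = length2 N p"
    using gen_length_word[OF ts(1) word] unfolding sym_group_mult sym_group_one by blast
  have "card (moved_space (foldr (\<circ>) us id)) \<le> 2 ^ length us"
    using us(1) transposition_permutes card_moved_space_transposition
    by (intro card_moved_space_word[of _ "{1..N}"]) blast+
  then show "card (moved_space p) \<le> 2 ^ length2 N p" unfolding us(2,3) .
  have "(2::nat) ^ length2 N p \<le> 2 ^ length ts"
    using gen_length_le[OF ts(1) word] by (rule power_increasing) simp
  then show "2 ^ length2 N p \<le> card (moved_space p)" using ts(3) by (rule order_trans)
qed

lemma inv_three_cycle:
  assumes "t \<in> three_cycles N" shows "inv' t \<in> three_cycles N"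
proof -
  obtain a b c where t: "t = transpose a b \<circ> transpose b c" "a \<noteq> b" "b \<noteq> c" "a \<noteq> c" "{a, b, c} \<subseteq> {1..N}"
    using assms by (rule three_cycleE)
  have "inv' t = transpose c b \<circ> transpose b a"
    unfolding t(1) by (simp add: o_inv_distrib transpose_commute)
  then show ?thesis using three_cycleI[of c b a N] t by auto
qed

lemma three_cycle_word_ex:
  assumes "p \<in> carrier (alt_group N)"
  shows "\<exists>ts. set ts \<subseteq> three_cycles N \<and> foldr (\<circ>) ts id = p"
  using assms unfolding alt_group_carrier_as_three_cycles
proof induction
  case one
  show ?case unfolding alt_group_one by (intro exI[of _ "[]"]) simp
next
  case (incl h)
  then show ?case by (intro exI[of _ "[h]"]) simp
next
  case (inv h)
  then have "inv\<^bsub>alt_group N\<^esub> h = inv' h"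
    using three_cycles_incl by (intro alt_group_inv_equality) blast
  with inv show ?case using inv_three_cycle by (intro exI[of _ "[inv' h]"]) simp
next
  case (eng h1 h2)
  then obtain ts us where ts: "set ts \<subseteq> three_cycles N" "foldr (\<circ>) ts id = h1"
    and us: "set us \<subseteq> three_cycles N" "foldr (\<circ>) us id = h2" by blast
  have "foldr (\<circ>) (ts @ us) id = foldr (\<circ>) ts id \<circ> foldr (\<circ>) us id" for ts us :: "(nat \<Rightarrow> nat) list"
    by (induction ts) (simp_all add: comp_assoc)
  from this[of ts us] have "foldr (\<circ>) (ts @ us) id = h1 \<circ> h2" unfolding ts us .
  moreover have "set (ts @ us) \<subseteq> three_cycles N" using ts(1) us(1) unfolding set_append by blast
  ultimately show ?case unfolding alt_group_mult by blast
qed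

lemma
  assumes p: "p \<in> carrier (alt_group N)"
  shows length2_le_length3: "length2 N p \<le> 2 * length3 N p"
    and length2_eq_length3_iff: "length2 N p = 2 * length3 N p \<longleftrightarrow> only_odd_cycles N p"
proof -
  have p': "p permutes {1..N}" using p by (simp add: alt_group_carrier)
  obtain ts where ts: "set ts \<subseteq> three_cycles N" "foldr (\<circ>) ts id = p"
    using three_cycle_word_ex[OF p] by blast
  obtain us where us: "set us \<subseteq> three_cycles N" "foldr (\<circ>) us id = p" "length us = length3 N p"
    using gen_length_word[of ts "three_cycles N" "alt_group N" p] ts
    unfolding alt_group_mult alt_group_one by blast
  have "card (moved_space p) \<le> 4 ^ length us"
    unfolding us(2)[symmetric] using us(1) three_cycle_permutes card_moved_space_three_cycle
    by (intro card_moved_space_word[of _ "{1..N}"]) blast+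
  then have "(2::nat) ^ length2 N p \<le> 2 ^ (2 * length3 N p)"
    by (simp add: us(3) card_moved_space_eq_length2[OF p'] power_mult)
  then show le: "length2 N p \<le> 2 * length3 N p" by simp
  show "length2 N p = 2 * length3 N p \<longleftrightarrow> only_odd_cycles N p"
  proof
    assume "length2 N p = 2 * length3 N p"
    then have "card (moved_space (foldr (\<circ>) us id)) = 4 ^ length us"
      by (simp add: us(2,3) card_moved_space_eq_length2[OF p'] power_mult)
    from three_cycle_word_odd_orbits[OF us(1) this] show "only_odd_cycles N p"
      by (simp add: us(2) only_odd_cycles_def)
  next
    assume "only_odd_cycles N p"
    then have "\<forall>f\<in>moved_space p. f \<circ> p = f \<longrightarrow> f = 0"
      using odd_orbits_iff_moved_space_nondegenerate[OF p'] by (simp add: only_odd_cycles_def)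
    from three_cycle_word[OF p' this] obtain vs where
      vs: "set vs \<subseteq> three_cycles N" "foldr (\<circ>) vs id = p" "4 ^ length vs \<le> card (moved_space p)"
      by blast
    have "length3 N p \<le> length vs"
      using vs(1,2) by (intro gen_length_le) (simp_all only: alt_group_mult alt_group_one)
    moreover have "(2::nat) ^ (2 * length vs) \<le> 2 ^ length2 N p"
      using vs(3) by (simp add: card_moved_space_eq_length2[OF p'] power_mult)
    then have "2 * length vs \<le> length2 N p" by simp
    ultimately show "length2 N p = 2 * length3 N p" using le by simp
  qed
qed

lemma length2_comp:
  assumes "p permutes {1..N}" "q permutes {1..N}"
  shows "length2 N (p \<circ> q) \<le> length2 N p + length2 N q"
proof -
  have "(2::nat) ^ length2 N (p \<circ> q) \<le> 2 ^ (length2 N p + length2 N q)"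
    using card_moved_space_comp[OF assms finite_atLeastAtMost]
    unfolding card_moved_space_eq_length2[OF assms(1)] card_moved_space_eq_length2[OF assms(2)]
      card_moved_space_eq_length2[OF permutes_compose[OF assms(2,1)]] power_add .
  then show ?thesis by simp
qed

lemma gen_length_one: "gen_length G T \<one>\<^bsub>G\<^esub> = 0"
  using gen_length_le[of "[]" T G "\<one>\<^bsub>G\<^esub>"] by simp

lemma le2_iff:
  assumes "p permutes {1..N}" "q permutes {1..N}"
  shows "le2 N p q \<longleftrightarrow> length2 N q = length2 N p + length2 N (inv' p \<circ> q)"
  using assms by (simp add: le2_def gen_le_def sym_group_carrier sym_group_mult)

lemma le3_iff:
  assumes "p \<in> carrier (alt_group N)" "q \<in> carrier (alt_group N)"
  shows "le3 N p q \<longleftrightarrow> length3 N q = length3 N p + length3 N (inv' p \<circ> q)"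
  using assms by (simp add: le3_def gen_le_def alt_group_mult alt_group_inv_equality)

theorem theorem4p1:
  fixes N :: nat and x :: "nat \<Rightarrow> nat"
  assumes "N \<ge> 3"
    and "x \<in> carrier (alt_group N)"
    and "only_odd_cycles N x"
  shows "interval3 N id x \<subseteq> interval2 N id x \<and>
    (\<forall>y\<in>interval3 N id x. \<forall>z\<in>interval3 N id x. le3 N y z \<longleftrightarrow> le2 N y z)"
proof -
  let ?A = "carrier (alt_group N)"
  note alt = alt_group_carrier[THEN iffD1, THEN conjunct1]
  have card_eq: "card (moved_space p) = 2 ^ length2 N p" if "p \<in> ?A" for p
    using alt[OF that] by (rule card_moved_space_eq_length2)
  have quotient: "inv' p \<circ> q \<in> ?A" if "p \<in> ?A" "q \<in> ?A" for p q
    using alt_group_inv_closed[OF that(1)] that(2)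
      monoid.m_closed[OF group.is_monoid[OF alt_group_is_group], of "inv' p" N q]
    by (simp add: alt_group_mult)
  have cancel: "p \<circ> (inv' p \<circ> q) = q" if "p \<in> ?A" for p q :: "nat \<Rightarrow> nat"
    using permutes_inv_o(1)[OF alt[OF that]] by (simp flip: comp_assoc)
  have id_in: "id \<in> ?A" by (simp add: alt_group_carrier permutes_id)
  have triangle: "length2 N q \<le> length2 N p + length2 N (inv' p \<circ> q)" if "p \<in> ?A" "q \<in> ?A" for p q
    using length2_comp[OF alt[OF that(1)] alt[OF quotient[OF that]]] cancel[OF that(1)] by simp
  have len_x: "length2 N x = 2 * length3 N x" using length2_eq_length3_iff[OF assms(2)] assms(3) by simp
  have below_x: "y \<in> ?A" "length2 N x = length2 N y + length2 N (inv' y \<circ> x)"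
      "length2 N y = 2 * length3 N y" "length2 N (inv' y \<circ> x) = 2 * length3 N (inv' y \<circ> x)"
    if "y \<in> interval3 N id x" for y
  proof -
    show y: "y \<in> ?A" using that by (simp add: interval3_def le3_def gen_le_def)
    have "le3 N y x" using that by (simp add: interval3_def)
    then have "length3 N x = length3 N y + length3 N (inv' y \<circ> x)"
      unfolding le3_iff[OF y assms(2)] .
    moreover have "length2 N y \<le> 2 * length3 N y" using y by (rule length2_le_length3)
    moreover have "length2 N (inv' y \<circ> x) \<le> 2 * length3 N (inv' y \<circ> x)"
      using quotient[OF y assms(2)] by (rule length2_le_length3)
    moreover note triangle[OF y assms(2)] len_x
    ultimately show "length2 N x = length2 N y + length2 N (inv' y \<circ> x)"
      "length2 N y = 2 * length3 N y" "length2 N (inv' y \<circ> x) = 2 * length3 N (inv' y \<circ> x)"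
      by linarith+
  qed
  have "interval3 N id x \<subseteq> interval2 N id x"
  proof
    fix y assume "y \<in> interval3 N id x"
    note y = below_x(1)[OF this] and len = below_x(2)[OF this]
    have "le2 N y x" unfolding le2_iff[OF alt[OF y] alt[OF assms(2)]] by (rule len)
    moreover have "length2 N id = 0" using gen_length_one[of "sym_group N"] by (simp add: sym_group_one)
    then have "le2 N id y" unfolding le2_iff[OF alt[OF id_in] alt[OF y]] by simp
    ultimately show "y \<in> interval2 N id x" by (simp add: interval2_def)
  qed
  moreover have "le3 N y z \<longleftrightarrow> le2 N y z"
    if y_int: "y \<in> interval3 N id x" and z_int: "z \<in> interval3 N id x" for y z
  proof -
    define w v where "w = inv' y \<circ> z" and "v = inv' z \<circ> x"
    note y = below_x(1)[OF y_int] and z = below_x(1)[OF z_int]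
    have w: "w \<in> ?A" unfolding w_def using y z by (rule quotient)
    have v: "v \<in> ?A" unfolding v_def using z assms(2) by (rule quotient)
    have yw: "y \<circ> w = z" and wv: "w \<circ> v = inv' y \<circ> x"
      unfolding w_def v_def comp_assoc cancel[OF y] cancel[OF z] by (rule refl)+
    have wv_in: "w \<circ> v \<in> ?A" unfolding wv using quotient[OF y assms(2)] .
    have le2: "le2 N y z \<longleftrightarrow> length2 N z = length2 N y + length2 N w"
      unfolding w_def using alt[OF y] alt[OF z] by (rule le2_iff)
    have le3: "le3 N y z \<longleftrightarrow> length3 N z = length3 N y + length3 N w"
      unfolding w_def using y z by (rule le3_iff)
    note len_y = below_x(3)[OF y_int] and len_z = below_x(3)[OF z_int]
      and len_wv = below_x(4)[OF y_int, folded wv] and len_v = below_x(4)[OF z_int, folded v_def]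
      and xy = below_x(2)[OF y_int, folded wv] and xz = below_x(2)[OF z_int, folded v_def]
    show ?thesis
    proof
      assume "le3 N y z"
      then show "le2 N y z"
        unfolding le2 le3 using len_y len_z length2_le_length3[OF w] triangle[OF y z, folded w_def]
        by linarith
    next
      assume "le2 N y z"
      then have yz: "length2 N z = length2 N y + length2 N w" using le2 by simp
      have "only_odd_cycles N w"
        unfolding only_odd_cycles_def
      proof (rule odd_orbits_middle_factor[OF alt[OF y] alt[OF w] alt[OF v] finite_atLeastAtMost])
        show "card (moved_space (y \<circ> w)) = card (moved_space y) * card (moved_space w)"
          unfolding yw card_eq[OF y] card_eq[OF z] card_eq[OF w] yz by (rule power_add)
        have "length2 N (w \<circ> v) = length2 N w + length2 N v" using yz xy xz by linarith
        then show "card (moved_space (w \<circ> v)) = card (moved_space w) * card (moved_space v)"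
          unfolding card_eq[OF wv_in] card_eq[OF w] card_eq[OF v] by (simp add: power_add)
        have x_eq: "y \<circ> (w \<circ> v) = x" unfolding wv by (rule cancel[OF y])
        show "card (moved_space (y \<circ> (w \<circ> v))) = card (moved_space y) * card (moved_space (w \<circ> v))"
          unfolding x_eq card_eq[OF assms(2)] card_eq[OF y] card_eq[OF wv_in] xy by (rule power_add)
        note odd = length2_eq_length3_iff[THEN iffD1, unfolded only_odd_cycles_def]
        show "\<forall>i\<in>{1..N}. odd (card (orbit y i))" by (rule odd[OF y len_y])
        show "\<forall>i\<in>{1..N}. odd (card (orbit v i))" by (rule odd[OF v len_v])
        show "\<forall>i\<in>{1..N}. odd (card (orbit (y \<circ> w) i))" unfolding yw by (rule odd[OF z len_z])
        show "\<forall>i\<in>{1..N}. odd (card (orbit (w \<circ> v) i))" by (rule odd[OF wv_in len_wv])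
      qed
      then have "length2 N w = 2 * length3 N w" using length2_eq_length3_iff[OF w] by blast
      then show "le3 N y z" unfolding le3 using yz len_y len_z by linarith
    qed
  qed
  ultimately show ?thesis by blast
qed

end
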